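(* Let $\mathcal{A}$ be a real line arrangement in $\mathbb{R}^2$ and let $\chi\in\mathrm{Der}_{\mathbb{R}}(\mathbb{R}[x,y])$. Then $\chi\in\mathcal{D}(\mathcal{A})$ if and only if $\mathcal{A}$ is invariant by $\chi$.
   Context: A real line arrangement is a finite nonempty set $\mathcal{A}=\{L_1,\dots,L_n\}$ of distinct (affine) lines in $\mathbb{R}^2$. For $L\in\mathcal{A}$ let $\alpha_L\in\mathbb{R}[x,y]$ be a polynomial of degree one with $L=\{\alpha_L=0\}$, and put $\mathcal{Q}_{\mathcal{A}}=\prod_{L\in\mathcal{A}}\alpha_L$. $\mathrm{Der}_{\mathbb{R}}(\mathbb{R}[x,y])$ is the set of $\mathbb{R}$-derivations of $\mathbb{R}[x,y]$; each is of the form $\chi=P\partial_x+Q\partial_y$ with $P,Q\in\mathbb{R}[x,y]$ and is identified with the polynomial vector field on $\mathbb{R}^2$ associated with the differential system $\frac{dx}{dt}=P(x,y)$, $\frac{dy}{dt}=Q(x,y)$. The module of $\mathcal{A}$-derivations is $$\mathcal{D}(\mathcal{A})=\{\chi\in\mathrm{Der}_{\mathbb{R}}(\mathbb{R}[x,y]) \mid \chi\mathcal{Q}_{\mathcal{A}}\in (\mathcal{Q}_{\mathcal{A}})\},$$ where $(\mathcal{Q}_{\mathcal{A}})$ is the ideal of $\mathbb{R}[x,y]$ generated by $\mathcal{Q}_{\mathcal{A}}$. A set $X\subset\mathbb{R}^2$ is invariant by $\chi$ if $\phi_t(X)\subset X$ for every $t\in\mathbb{R}$, where $\phi_t$ is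 the flow of $\chi$ at time $t$ (since the flow need not be complete, this means: $\phi_t(p)\in X$ for all $p\in X$ and all $t$ for which $\phi_t(p)$ is defined). The arrangement $\mathcal{A}$ is invariant by $\chi$ if the union of its lines is an invariant set. *)

theory Defs
  imports "HOL-Analysis.Analysis" "HOL-Computational_Algebra.Polynomial"
begin

text \<open>
  The ring of real polynomials in two variables is modelled as R[x][y]: the outer variable is y and
  the coefficients are polynomials in x. The plane is the type of pairs of reals.
\<close>

type_synonym bipoly = "real poly poly"

definition var_x :: bipoly where
  "var_x = [:[:0, 1:]:]"

definition var_y :: bipoly where
  "var_y = [:0, 1:]"

definition eval2 :: "bipoly \<Rightarrow> real \<times> real \<Rightarrow> real" where
  "eval2 f p = poly (poly f [:snd p:]) (fst p)"

lemma eval2_var_x [simp]: "eval2 var_x p = fst p"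
  by (simp add: eval2_def var_x_def)

lemma eval2_var_y [simp]: "eval2 var_y p = snd p"
  by (simp add: eval2_def var_y_def)

text \<open>
  The total degree; \<open>coeff (coeff f j) i\<close> is the coefficient of \<open>x\<^sup>i y\<^sup>j\<close>. The zero polynomial gets degree 0.
\<close>

definition total_degree :: "bipoly \<Rightarrow> nat" where
  "total_degree f = Max (insert 0 {i + j | i j. coeff (coeff f j) i \<noteq> 0})"

definition zero_set :: "bipoly \<Rightarrow> (real \<times> real) set" where
  "zero_set f = {p. eval2 f p = 0}"

definition principal_ideal :: "bipoly \<Rightarrow> bipoly set" where
  "principal_ideal f = range (\<lambda>g. g * f)"

text \<open>A real constant \<open>c\<close> acts on polynomials as multiplication by \<open>[:[:c:]:]\<close>, i.e. as \<open>smult [:c:]\<close>.\<close>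

definition Der :: "(bipoly \<Rightarrow> bipoly) set" where
  "Der = {\<theta>. (\<forall>f g. \<theta> (f + g) = \<theta> f + \<theta> g) \<and>
              (\<forall>c f. \<theta> (smult [:c:] f) = smult [:c:] (\<theta> f)) \<and>
              (\<forall>f g. \<theta> (f * g) = f * \<theta> g + g * \<theta> f)}"

definition line_arrangement :: "(real \<times> real) set set \<Rightarrow> bool" where
  "line_arrangement \<A> \<longleftrightarrow> finite \<A> \<and> \<A> \<noteq> {} \<and> (\<forall>L\<in>\<A>. affine L \<and> aff_dim L = 1)"

text \<open>
  \<open>\<alpha>\<close> selects for every line of the arrangement a defining polynomial of degree one. The defining
  polynomial of a line is unique only up to a nonzero constant, so the selection is a parameter.
\<close>

definition defining_polys :: "(real \<times> real) set set \<Rightarrow> ((real \<times> real) set \<Rightarrow> bipoly) \<Rightarrow> bool" where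
  "defining_polys \<A> \<alpha> \<longleftrightarrow> (\<forall>L\<in>\<A>. total_degree (\<alpha> L) = 1 \<and> L = zero_set (\<alpha> L))"

definition arrangement_poly ::
    "(real \<times> real) set set \<Rightarrow> ((real \<times> real) set \<Rightarrow> bipoly) \<Rightarrow> bipoly" where
  "arrangement_poly \<A> \<alpha> = (\<Prod>L\<in>\<A>. \<alpha> L)"

definition arrangement_derivations ::
    "(real \<times> real) set set \<Rightarrow> ((real \<times> real) set \<Rightarrow> bipoly) \<Rightarrow> (bipoly \<Rightarrow> bipoly) set" where
  "arrangement_derivations \<A> \<alpha> =
     {\<theta> \<in> Der. \<theta> (arrangement_poly \<A> \<alpha>) \<in> principal_ideal (arrangement_poly \<A> \<alpha>)}"

text \<open>
  A derivation \<open>P \<partial>\<^sub>x + Q \<partial>\<^sub>y\<close> has \<open>P = \<theta> x\<close> and \<open>Q = \<theta> y\<close>, which gives the associated vector field.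
\<close>

definition vector_field :: "(bipoly \<Rightarrow> bipoly) \<Rightarrow> real \<times> real \<Rightarrow> real \<times> real" where
  "vector_field \<theta> p = (eval2 (\<theta> var_x) p, eval2 (\<theta> var_y) p)"

definition integral_curve ::
    "(bipoly \<Rightarrow> bipoly) \<Rightarrow> real set \<Rightarrow> (real \<Rightarrow> real \<times> real) \<Rightarrow> bool" where
  "integral_curve \<theta> J \<gamma> \<longleftrightarrow>
     (\<forall>s\<in>J. (\<gamma> has_vector_derivative vector_field \<theta> (\<gamma> s)) (at s))"

text \<open>
  The graph of the (possibly incomplete) flow: \<open>flow_rel \<theta> t p q\<close> says that \<open>\<phi>\<^sub>t(p)\<close> is defined and
  equal to \<open>q\<close>. For a derivation \<open>\<theta>\<close>, uniqueness of solutions makes \<open>q\<close> determined by \<open>t\<close> and \<open>p\<close>, and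
  the times for which some \<open>q\<close> exists form the maximal interval of existence at \<open>p\<close>.
\<close>

definition flow_rel ::
    "(bipoly \<Rightarrow> bipoly) \<Rightarrow> real \<Rightarrow> real \<times> real \<Rightarrow> real \<times> real \<Rightarrow> bool" where
  "flow_rel \<theta> t p q \<longleftrightarrow>
     (\<exists>J \<gamma>. open J \<and> is_interval J \<and> 0 \<in> J \<and> t \<in> J \<and>
            integral_curve \<theta> J \<gamma> \<and> \<gamma> 0 = p \<and> \<gamma> t = q)"

definition invariant_set :: "(bipoly \<Rightarrow> bipoly) \<Rightarrow> (real \<times> real) set \<Rightarrow> bool" where
  "invariant_set \<theta> X \<longleftrightarrow> (\<forall>t. \<forall>p\<in>X. \<forall>q. flow_rel \<theta> t p q \<longrightarrow> q \<in> X)"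

definition invariant_arrangement :: "(bipoly \<Rightarrow> bipoly) \<Rightarrow> (real \<times> real) set set \<Rightarrow> bool" where
  "invariant_arrangement \<theta> \<A> \<longleftrightarrow> invariant_set \<theta> (\<Union>\<A>)"

end

theory Submission imports Defs begin

text \<open>
  If \<open>\<theta> Q = k Q\<close>, then along an integral curve \<open>Q\<close> solves the linear equation \<open>u' = k u\<close>, so it stays
  zero once it is zero. Conversely, let the union of the lines be invariant and let \<open>p\<close> lie on exactly
  one line \<open>L\<close>. An integral curve through \<open>p\<close>, which exists by Picard's theorem, stays on \<open>L\<close> for a
  short time, so differentiating \<open>\<alpha>\<^sub>L = 0\<close> along it gives \<open>\<theta> \<alpha>\<^sub>L = 0\<close> at \<open>p\<close>. There are infinitely many such
  \<open>p\<close> on \<open>L\<close>, hence \<open>\<alpha>\<^sub>L\<close> divides \<open>\<theta> \<alpha>\<^sub>L\<close>, and the Leibniz rule passes this on to the product.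
\<close>

section \<open>Polynomials in two variables\<close>

lemma eval2_add [simp]: "eval2 (f + g) p = eval2 f p + eval2 g p"
  by (simp add: eval2_def)

lemma eval2_mult [simp]: "eval2 (f * g) p = eval2 f p * eval2 g p"
  by (simp add: eval2_def)

lemma eval2_const [simp]: "eval2 [:[:c:]:] p = c"
  by (simp add: eval2_def)

lemma eval2_1 [simp]: "eval2 1 p = 1"
  by (simp add: eval2_def)

lemma eval2_prod: "eval2 (prod f A) p = (\<Prod>i\<in>A. eval2 (f i) p)"
  by (induction A rule: infinite_finite_induct) auto

lemma eval2_linear: "eval2 [:[:c, a:], [:b:]:] p = a * fst p + b * snd p + c"
  by (simp add: eval2_def algebra_simps)

text \<open>Constants, \<open>var_x\<close> and \<open>var_y\<close> generate the ring as an
  algebra: nested Horner schemes, first in x for each coefficient, then in y. Facts about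
  \<open>eval2\<close> can thus be checked on generators and carried through sums and
  products.\<close>

lemma bipoly_induct [case_names const x y add mult]:
  assumes const: "\<And>c. P [:[:c:]:]"
    and x: "P var_x" and y: "P var_y"
    and add: "\<And>f g. P f \<Longrightarrow> P g \<Longrightarrow> P (f + g)"
    and mult: "\<And>f g. P f \<Longrightarrow> P g \<Longrightarrow> P (f * g)"
  shows "P (f :: bipoly)"
proof (induction f)
  case 0
  show ?case using const[of 0] by simp
next
  case (pCons q f)
  have "P [:q:]"
  proof (induction q)
    case 0
    show ?case using const[of 0] by simp
  next
    case (pCons c q)
    have "[:pCons c q:] = [:[:c:]:] + var_x * [:q:]"
      by (simp add: var_x_def)
    then show ?case using add[OF const mult[OF x pCons.IH]] by simp
  qed
  moreover have "pCons q f = [:q:] + var_y * f"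
    by (simp add: var_y_def)
  ultimately show ?case using add mult[OF y pCons.IH] by simp
qed

section \<open>Continuity and Lipschitz bounds of polynomial functions\<close>

lemma continuous_on_eval2 [continuous_intros]:
  assumes "continuous_on S g"
  shows "continuous_on S (\<lambda>s. eval2 f (g s))"
  by (induction f rule: bipoly_induct) (auto intro!: continuous_intros assms)

text \<open>Supplies the hypothesis of Picard's theorem. Boundedness of \<open>S\<close> enters in
  the product case: a product of Lipschitz functions is Lipschitz once both factors are bounded, and
  a polynomial is bounded on the compact closure of \<open>S\<close>.\<close>

lemma lipschitz_on_eval2:
  assumes "bounded S"
  shows "\<exists>K. K-lipschitz_on S (eval2 f)"
proof -
  have bdd: "\<exists>B\<ge>0. \<forall>p\<in>S. \<bar>eval2 f p\<bar> \<le> B" for f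
  proof -
    have "compact (closure S)" using assms by simp
    then have "compact (eval2 f ` closure S)"
      by (intro compact_continuous_image continuous_intros)
    then obtain B where "\<forall>v\<in>eval2 f ` closure S. norm v \<le> B"
      using bounded_iff compact_imp_bounded by blast
    \<comment> \<open>If \<open>S\<close> is empty, nothing forces \<open>B\<close> to be
      nonnegative; the maximum with 0 does.\<close>
    then have "\<forall>p\<in>S. \<bar>eval2 f p\<bar> \<le> max 0 B"
      using closure_subset[of S] by (force simp: max_def)
    then show ?thesis by (intro exI[of _ "max 0 B"]) auto
  qed
  show ?thesis
  proof (induction f rule: bipoly_induct)
    case (const c)
    have "0-lipschitz_on S (\<lambda>p. c)" by (rule lipschitz_on_constant)
    then show ?case by (auto simp: lipschitz_on_def)
  next
    case x
    have "1-lipschitz_on S (eval2 var_x)"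
      by (rule lipschitz_onI) (auto simp: dist_fst_le)
    then show ?case by blast
  next
    case y
    have "1-lipschitz_on S (eval2 var_y)"
      by (rule lipschitz_onI) (auto simp: dist_snd_le)
    then show ?case by blast
  next
    case (add f g)
    then obtain K L where "K-lipschitz_on S (eval2 f)" "L-lipschitz_on S (eval2 g)"
      by blast
    from lipschitz_on_add[OF this] show ?case
      by (auto simp: lipschitz_on_def)
  next
    case (mult f g)
    then obtain K L where K: "K-lipschitz_on S (eval2 f)" and L: "L-lipschitz_on S (eval2 g)"
      by blast
    obtain A where A: "A \<ge> 0" "\<And>p. p \<in> S \<Longrightarrow> \<bar>eval2 f p\<bar> \<le> A" using bdd by blast
    obtain B where B: "B \<ge> 0" "\<And>p. p \<in> S \<Longrightarrow> \<bar>eval2 g p\<bar> \<le> B" using bdd by blast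
    have "(A * L + K * B)-lipschitz_on S (eval2 (f * g))"
    proof (rule lipschitz_onI)
      show "0 \<le> A * L + K * B"
        using A B K L by (simp add: lipschitz_on_nonneg)
    next
      fix p q assume pq: "p \<in> S" "q \<in> S"
      have "dist (eval2 (f * g) p) (eval2 (f * g) q) =
          \<bar>eval2 f p * (eval2 g p - eval2 g q) + (eval2 f p - eval2 f q) * eval2 g q\<bar>"
        by (simp add: dist_real_def algebra_simps)
      also have "\<dots> \<le> \<bar>eval2 f p\<bar> * \<bar>eval2 g p - eval2 g q\<bar> + \<bar>eval2 f p - eval2 f q\<bar> * \<bar>eval2 g q\<bar>"
        by (metis abs_mult abs_triangle_ineq)
      also have "\<dots> \<le> A * (L * dist p q) + (K * dist p q) * B"
        using lipschitz_onD[OF K pq] lipschitz_onD[OF L pq] A B pq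
        by (intro add_mono mult_mono) (auto simp: dist_real_def lipschitz_on_nonneg[OF K])
      finally show "dist (eval2 (f * g) p) (eval2 (f * g) q) \<le> (A * L + K * B) * dist p q"
        by (simp add: algebra_simps)
    qed
    then show ?case by blast
  qed
qed

section \<open>Polynomials of degree one and division by them\<close>

lemma eval2_eq_poly_map_poly: "eval2 f (x, y) = poly (map_poly (\<lambda>c. poly c x) f) y"
  by (induction f) (auto simp: eval2_def map_poly_pCons)

lemma eval2_eq_poly_subst: "eval2 f (x, poly r x) = poly (poly f r) x"
  by (induction f) (auto simp: eval2_def)

lemma total_degree_1_linear:
  assumes "total_degree f = 1"
  obtains a b c where "f = [:[:c, a:], [:b:]:]" "a \<noteq> 0 \<or> b \<noteq> 0"
proof -
  define D where "D = {i + j | i j. coeff (coeff f j) i \<noteq> 0}"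
  \<comment> \<open>\<open>Max\<close> is informative only for a finite set; the exponents of
    nonzero coefficients are bounded by the degrees in y and in x.\<close>
  have "D \<subseteq> (\<lambda>(i, j). i + j) ` (SIGMA j:{..degree f}. {..degree (coeff f j)})"
  proof
    fix d assume "d \<in> D"
    then obtain i j where d: "d = i + j" "coeff (coeff f j) i \<noteq> 0" unfolding D_def by blast
    then have "coeff f j \<noteq> 0" by auto
    with d(2) have "(j, i) \<in> (SIGMA j:{..degree f}. {..degree (coeff f j)})"
      by (auto intro: le_degree)
    then show "d \<in> (\<lambda>(i, j). i + j) ` (SIGMA j:{..degree f}. {..degree (coeff f j)})"
      by (rule rev_image_eqI) (simp add: d)
  qed
  then have fin: "finite D" by (rule finite_subset) auto
  have Max: "Max (insert 0 D) = 1"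
    using assms by (simp add: total_degree_def D_def)
  have le: "i + j \<le> 1" if "coeff (coeff f j) i \<noteq> 0" for i j
  proof -
    have "i + j \<in> insert 0 D" using that by (auto simp: D_def)
    then show ?thesis using Max_ge[of "insert 0 D" "i + j"] fin Max by simp
  qed
  \<comment> \<open>The maximum 1 is not the inserted 0, so some coefficient of degree exactly one
    is nonzero; it is \<open>a\<close> or \<open>b\<close>.\<close>
  have "1 \<in> D" using Max_in[of "insert 0 D"] fin Max by auto
  then obtain i j where ij: "i + j = 1" "coeff (coeff f j) i \<noteq> 0" unfolding D_def by auto
  define a b c where "a = coeff (coeff f 0) 1" and "b = coeff (coeff f 1) 0"
    and "c = coeff (coeff f 0) 0"
  have "f = [:[:c, a:], [:b:]:]"
  proof (intro poly_eqI)
    fix j i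
    show "coeff (coeff f j) i = coeff (coeff [:[:c, a:], [:b:]:] j) i"
      using le[of j i] by (cases "coeff (coeff f j) i = 0") (auto simp: a_def b_def c_def coeff_pCons split: nat.splits)
  qed
  moreover have "a \<noteq> 0 \<or> b \<noteq> 0"
    using ij unfolding a_def b_def by (cases i; cases j; auto)
  ultimately show thesis using that by blast
qed

text \<open>Restricting \<open>f\<close> to the line gives a polynomial in one variable with
  infinitely many roots, hence zero. A non-vertical line is a graph y = r(x), and \<open>f\<close>,
  as a polynomial in y over R[x], then has the root r and the factor y - r. A vertical line is
  treated through the coefficients of \<open>f\<close>.\<close>

lemma linear_dvd_if_infinite_zeros:
  assumes "total_degree l = 1" and inf: "infinite (zero_set l \<inter> zero_set f)"
  shows "l dvd f"
proof -
  obtain a b c where l: "l = [:[:c, a:], [:b:]:]" and ab: "a \<noteq> 0 \<or> b \<noteq> 0"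
    using total_degree_1_linear assms(1) by blast
  show ?thesis
  proof (cases "b = 0")
    case False
    define r where "r = [:- c / b, - a / b:]"
    have on_l: "snd p = poly r (fst p)" if "p \<in> zero_set l" for p
      using that False
      by (auto simp: zero_set_def l eval2_linear r_def field_simps)
    have "zero_set l \<inter> zero_set f \<subseteq> (\<lambda>x. (x, poly r x)) ` {x. poly (poly f r) x = 0}"
    proof
      fix p assume p: "p \<in> zero_set l \<inter> zero_set f"
      then have "p = (fst p, poly r (fst p))" using on_l[of p] by (simp add: prod_eq_iff)
      moreover from this p have "poly (poly f r) (fst p) = 0"
        unfolding eval2_eq_poly_subst[symmetric] zero_set_def by simp
      ultimately show "p \<in> (\<lambda>x. (x, poly r x)) ` {x. poly (poly f r) x = 0}" by blast
    qed
    then have "infinite {x. poly (poly f r) x = 0}"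
      using inf finite_subset by blast
    then have "poly f r = 0" using poly_roots_finite by blast
    then have "[:- r, 1:] dvd f" by (simp add: poly_eq_0_iff_dvd)
    then obtain g where "f = [:- r, 1:] * g" by (rule dvdE)
    moreover have "[:- r, 1:] = l * [:[:1 / b:]:]"
      using False by (simp add: l r_def)
    ultimately have "f = l * ([:[:1 / b:]:] * g)" by (simp only: mult.assoc)
    then show ?thesis by (rule dvdI)
  next
    case True
    with ab have a: "a \<noteq> 0" by simp
    define x0 where "x0 = - c / a"
    \<comment> \<open>The restriction of \<open>f\<close> to the vertical line x = x0, as a
      polynomial in y. If it is zero, every coefficient of \<open>f\<close> has the root x0 and is
      therefore divisible by \<open>[:c, a:]\<close>.\<close>
    let ?g = "map_poly (\<lambda>q. poly q x0) f"
    have "zero_set l \<inter> zero_set f \<subseteq> Pair x0 ` {y. poly ?g y = 0}"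
    proof
      fix p assume p: "p \<in> zero_set l \<inter> zero_set f"
      then have "a * fst p + b * snd p + c = 0"
        by (simp only: zero_set_def l eval2_linear Int_iff mem_Collect_eq)
      then have "fst p = x0"
        using a True by (simp add: x0_def field_simps)
      then have p': "p = (x0, snd p)" by (simp add: prod_eq_iff)
      with p have "poly ?g (snd p) = 0"
        unfolding eval2_eq_poly_map_poly[symmetric] zero_set_def by simp
      with p' show "p \<in> Pair x0 ` {y. poly ?g y = 0}" by blast
    qed
    then have "infinite {y. poly ?g y = 0}" using inf finite_subset by blast
    then have g: "?g = 0" using poly_roots_finite by blast
    have "[:c, a:] dvd coeff f n" for n
    proof -
      have "poly (coeff f n) x0 = 0"
        using arg_cong[OF g, of "\<lambda>h. coeff h n"] by (simp add: coeff_map_poly)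
      then have "[:- x0, 1:] dvd coeff f n" by (simp add: poly_eq_0_iff_dvd)
      moreover have "[:c, a:] = smult a [:- x0, 1:]" using a by (simp add: x0_def)
      ultimately show ?thesis using a by (metis smult_dvd)
    qed
    then show ?thesis by (simp add: l True const_poly_dvd_iff)
  qed
qed

section \<open>Derivations and differential equations\<close>

text \<open>The Leibniz rule for 1 * 1 gives \<theta> 1 = 2 \<theta> 1, so \<theta> 1 = 0; linearity
  over the reals does the rest.\<close>

lemma Der_const:
  assumes "\<theta> \<in> Der"
  shows "\<theta> [:[:c:]:] = 0"
proof -
  have "\<theta> (1 * 1) = 1 * \<theta> 1 + 1 * \<theta> 1" using assms unfolding Der_def by blast
  then have "\<theta> 1 = 0" by simp
  moreover have "\<theta> (smult [:c:] 1) = smult [:c:] (\<theta> 1)" using assms unfolding Der_def by blast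
  ultimately show ?thesis by simp
qed

text \<open>The link between algebra and dynamics: applying \<theta> to a polynomial is
  differentiating it along integral curves. On \<open>var_x\<close> and \<open>var_y\<close> this is
  the definition of the vector field, and the Leibniz rule matches the product rule.\<close>

lemma has_real_derivative_eval2:
  assumes "\<theta> \<in> Der" and \<gamma>: "(\<gamma> has_vector_derivative vector_field \<theta> (\<gamma> s)) (at s)"
  shows "((\<lambda>s. eval2 f (\<gamma> s)) has_real_derivative eval2 (\<theta> f) (\<gamma> s)) (at s)"
proof (induction f rule: bipoly_induct)
  case (const c)
  have "((\<lambda>s. c) has_real_derivative 0) (at s)" by simp
  then show ?case using Der_const[OF assms(1)] eval2_const[of 0] by simp
next
  case x
  have "((\<lambda>s. fst (\<gamma> s)) has_vector_derivative fst (vector_field \<theta> (\<gamma> s))) (at s)"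
    using bounded_linear.has_vector_derivative[OF bounded_linear_fst \<gamma>] .
  then show ?case by (simp add: has_real_derivative_iff_has_vector_derivative vector_field_def)
next
  case y
  have "((\<lambda>s. snd (\<gamma> s)) has_vector_derivative snd (vector_field \<theta> (\<gamma> s))) (at s)"
    using bounded_linear.has_vector_derivative[OF bounded_linear_snd \<gamma>] .
  then show ?case by (simp add: has_real_derivative_iff_has_vector_derivative vector_field_def)
next
  case (add f g)
  have "\<theta> (f + g) = \<theta> f + \<theta> g" using assms(1) unfolding Der_def by blast
  with DERIV_add[OF add] show ?case by simp
next
  case (mult f g)
  have "\<theta> (f * g) = f * \<theta> g + g * \<theta> f" using assms(1) unfolding Der_def by blast
  with DERIV_mult[OF mult] show ?case by (simp add: algebra_simps)
qed

text \<open>Integrating factor: with K an antiderivative of k, the product of f and exp(-K) has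
  derivative zero, so it is constant, and exp never vanishes.\<close>

lemma linear_ode_zero:
  fixes f k :: "real \<Rightarrow> real"
  assumes J: "is_interval J" "t\<^sub>0 \<in> J" "t \<in> J"
    and f: "\<And>s. s \<in> J \<Longrightarrow> (f has_real_derivative k s * f s) (at s)"
    and k: "continuous_on J k" and "f t\<^sub>0 = 0"
  shows "f t = 0"
proof -
  \<comment> \<open>The minimum and maximum allow \<open>t\<close> to lie on either side of
    \<open>t\<^sub>0\<close>.\<close>
  define I where "I = {min t\<^sub>0 t..max t\<^sub>0 t}"
  have IJ: "I \<subseteq> J"
  proof
    fix s assume "s \<in> I"
    then have "min t\<^sub>0 t \<le> s" "s \<le> max t\<^sub>0 t" by (auto simp: I_def)
    moreover have "min t\<^sub>0 t \<in> J" "max t\<^sub>0 t \<in> J"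
      using J(2,3) by (simp_all add: min_def max_def)
    ultimately show "s \<in> J" using J(1) unfolding is_interval_1 by blast
  qed
  have "continuous_on I k" using k IJ continuous_on_subset by blast
  then obtain K where K: "\<And>s. s \<in> I \<Longrightarrow> (K has_vector_derivative k s) (at s within I)"
    unfolding I_def by (rule antiderivative_continuous) blast
  have "((\<lambda>s. f s * exp (- K s)) has_real_derivative 0) (at s within I)" if "s \<in> I" for s
  proof -
    have "(f has_real_derivative k s * f s) (at s within I)"
      using f IJ that by (blast intro: has_field_derivative_at_within)
    moreover have "(K has_real_derivative k s) (at s within I)"
      using K[OF that] by (simp add: has_real_derivative_iff_has_vector_derivative)
    ultimately have "((\<lambda>s. f s * exp (- K s)) has_real_derivative
        k s * f s * exp (- K s) + exp (- K s) * - k s * f s) (at s within I)"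
      by (intro DERIV_mult DERIV_chain2[OF DERIV_exp] DERIV_minus)
    then show ?thesis by simp
  qed
  moreover have "convex I" by (simp add: I_def)
  ultimately have "\<exists>c. \<forall>s\<in>I. f s * exp (- K s) = c"
    by (intro has_field_derivative_zero_constant)
  then obtain c where c: "\<And>s. s \<in> I \<Longrightarrow> f s * exp (- K s) = c" by blast
  have "t\<^sub>0 \<in> I" "t \<in> I" by (auto simp: I_def)
  then have "f t * exp (- K t) = f t\<^sub>0 * exp (- K t\<^sub>0)" using c by metis
  then show ?thesis using \<open>f t\<^sub>0 = 0\<close> by simp
qed

section \<open>Local existence of integral curves\<close>

text \<open>
  The Picard operator acts on bounded continuous functions on the whole line: the time argument is
  clamped to \<open>[-a, a]\<close>, with \<open>a\<close> small enough for a contraction.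
\<close>

lemma picard_global:
  fixes G :: "'a::euclidean_space \<Rightarrow> 'a"
  assumes G: "K-lipschitz_on UNIV G"
  obtains a \<gamma> where "a > 0" "\<gamma> 0 = p"
    "\<And>s. s \<in> {-a<..<a} \<Longrightarrow> (\<gamma> has_vector_derivative G (\<gamma> s)) (at s)"
proof -
  have K0: "K \<ge> 0" using G by (rule lipschitz_on_nonneg)
  \<comment> \<open>The Picard operator below is a difference of two integrals over intervals of
    length at most 2a, so its Lipschitz constant is at most 4aK = K / (2(K + 1)), which is at most
    1/2. Adding 1 to K avoids division by zero.\<close>
  define a where "a = 1 / (8 * (K + 1))"
  have a: "a > 0" and Ka: "4 * a * K \<le> 1 / 2"
    using K0 by (auto simp: a_def field_simps)
  define cl where "cl t = max (- a) (min a t)" for t :: real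
  have cl: "cl t \<in> {-a..a}" "continuous_on UNIV cl" for t
    using a by (auto simp: cl_def[abs_def] intro!: continuous_intros)
  have Gc: "continuous_on S (\<lambda>s. G (apply_bcontfun \<gamma> s))" for S :: "real set" and \<gamma>
    using continuous_on_compose2[OF lipschitz_on_continuous_on[OF G]] by auto
  \<comment> \<open>The oriented integral from 0 to u, written as a difference of integrals starting
    at -a so that negative u is covered as well.\<close>
  define V where "V \<gamma> u = p + (integral {-a..u} (\<lambda>s. G (apply_bcontfun \<gamma> s)) -
     integral {-a..0} (\<lambda>s. G (apply_bcontfun \<gamma> s)))" for \<gamma> u
  have V': "(V \<gamma> has_vector_derivative G (apply_bcontfun \<gamma> u)) (at u within {-a..a})"
    if "u \<in> {-a..a}" for \<gamma> u
    unfolding V_def using integral_has_vector_derivative[OF Gc that]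
    by (auto intro!: derivative_eq_intros)
  have Vc: "continuous_on {-a..a} (V \<gamma>)" for \<gamma>
    using V' by (rule continuous_on_vector_derivative)
  have Vb: "(\<lambda>t. V \<gamma> (cl t)) \<in> bcontfun" for \<gamma>
  proof -
    have "compact (V \<gamma> ` {-a..a})" using Vc by (intro compact_continuous_image) auto
    moreover have "range (\<lambda>t. V \<gamma> (cl t)) \<subseteq> V \<gamma> ` {-a..a}" using cl by blast
    ultimately have "bounded (range (\<lambda>t. V \<gamma> (cl t)))"
      using bounded_subset compact_imp_bounded by blast
    moreover have "continuous_on UNIV (\<lambda>t. V \<gamma> (cl t))"
      using continuous_on_compose2[OF Vc cl(2)] cl(1) by blast
    ultimately show ?thesis by (simp add: bcontfun_def)
  qed
  define T where "T \<gamma> = Bcontfun (\<lambda>t. V \<gamma> (cl t))" for \<gamma>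
  have T: "apply_bcontfun (T \<gamma>) t = V \<gamma> (cl t)" for \<gamma> t
    unfolding T_def using Bcontfun_inverse[OF Vb] by simp
  have "dist (T \<gamma>) (T \<eta>) \<le> (1 / 2) * dist \<gamma> \<eta>" for \<gamma> \<eta>
  proof (rule dist_bound)
    fix t
    define h where "h s = G (apply_bcontfun \<gamma> s) - G (apply_bcontfun \<eta> s)" for s
    have h: "norm (h s) \<le> K * dist \<gamma> \<eta>" for s
    proof -
      have "norm (h s) \<le> K * dist (apply_bcontfun \<gamma> s) (apply_bcontfun \<eta> s)"
        using lipschitz_onD[OF G] by (simp add: h_def dist_norm)
      also have "\<dots> \<le> K * dist \<gamma> \<eta>"
        using K0 by (intro mult_left_mono dist_bounded)
      finally show ?thesis .
    qed
    have hc: "continuous_on S h" for S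
      unfolding h_def by (intro continuous_intros Gc)
    have hi: "norm (integral {-a..u} h) \<le> K * dist \<gamma> \<eta> * (2 * a)" if "u \<in> {-a..a}" for u
    proof -
      have "norm (integral {-a..u} h) \<le> K * dist \<gamma> \<eta> * (u - - a)"
        using that h hc by (intro integral_bound) auto
      also have "\<dots> \<le> K * dist \<gamma> \<eta> * (2 * a)"
        using that K0 by (intro mult_left_mono) auto
      finally show ?thesis .
    qed
    have hd: "integral {-a..u} h = integral {-a..u} (\<lambda>s. G (apply_bcontfun \<gamma> s))
        - integral {-a..u} (\<lambda>s. G (apply_bcontfun \<eta> s))" for u
      unfolding h_def by (intro integral_diff integrable_continuous_real Gc)
    have "dist (T \<gamma> t) (T \<eta> t) = norm (integral {-a..cl t} h - integral {-a..0} h)"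
      by (simp add: T V_def hd dist_norm algebra_simps)
    also have "\<dots> \<le> K * dist \<gamma> \<eta> * (2 * a) + K * dist \<gamma> \<eta> * (2 * a)"
      using a cl(1) by (intro norm_triangle_le_diff add_mono hi) auto
    also have "\<dots> = (4 * a * K) * dist \<gamma> \<eta>" by simp
    also have "\<dots> \<le> (1 / 2) * dist \<gamma> \<eta>" using Ka by (intro mult_right_mono) auto
    finally show "dist (T \<gamma> t) (T \<eta> t) \<le> (1 / 2) * dist \<gamma> \<eta>" .
  qed
  then obtain \<gamma> where fixpoint: "T \<gamma> = \<gamma>"
    using banach_fix_type[of "1 / 2" T] by auto
  \<comment> \<open>On [-a, a] the clamp is the identity, so the fixed point satisfies the integral
    equation there.\<close>
  have eq: "apply_bcontfun \<gamma> t = V \<gamma> t" if "t \<in> {-a..a}" for t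
    using T[of \<gamma> t] that by (simp add: fixpoint cl_def)
  show thesis
  proof (rule that[OF a])
    show "apply_bcontfun \<gamma> 0 = p" using eq[of 0] a by (simp add: V_def)
    fix s assume s: "s \<in> {-a<..<a}"
    then have "(V \<gamma> has_vector_derivative G (apply_bcontfun \<gamma> s)) (at s within {-a..a})"
      by (intro V') auto
    then have "(apply_bcontfun \<gamma> has_vector_derivative G (apply_bcontfun \<gamma> s)) (at s within {-a..a})"
      using eq s by (auto intro: has_vector_derivative_transform)
    then show "(apply_bcontfun \<gamma> has_vector_derivative G (apply_bcontfun \<gamma> s)) (at s)"
      using s by (simp add: at_within_Icc_at)
  qed
qed

text \<open>The field is composed with the projection onto the ball, which makes it globally Lipschitz.\<close>

lemma picard_local:
  fixes F :: "'a::euclidean_space \<Rightarrow> 'a"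
  assumes "r > 0" and F: "K-lipschitz_on (cball p r) F"
  obtains a \<gamma> where "a > 0" "\<gamma> 0 = p"
    "\<And>s. s \<in> {-a<..<a} \<Longrightarrow> (\<gamma> has_vector_derivative F (\<gamma> s)) (at s)"
proof -
  let ?\<pi> = "closest_point (cball p r)"
  have ne: "cball p r \<noteq> {}" using \<open>r > 0\<close> by simp
  have "K-lipschitz_on UNIV (\<lambda>x. F (?\<pi> x))"
  proof (rule lipschitz_onI)
    show "0 \<le> K" using F by (rule lipschitz_on_nonneg)
    fix x y :: 'a
    have "dist (F (?\<pi> x)) (F (?\<pi> y)) \<le> K * dist (?\<pi> x) (?\<pi> y)"
      using ne by (intro lipschitz_onD[OF F] closest_point_in_set) auto
    also have "\<dots> \<le> K * dist x y"
      using ne \<open>0 \<le> K\<close> by (intro mult_left_mono closest_point_lipschitz) auto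
    finally show "dist (F (?\<pi> x)) (F (?\<pi> y)) \<le> K * dist x y" .
  qed
  then obtain b \<gamma> where b: "b > 0" and \<gamma>0: "\<gamma> 0 = p" and
    \<gamma>: "\<And>s. s \<in> {-b<..<b} \<Longrightarrow> (\<gamma> has_vector_derivative F (?\<pi> (\<gamma> s))) (at s)"
    using picard_global[of K "\<lambda>x. F (?\<pi> x)" p] by blast
  \<comment> \<open>By continuity the curve stays in the ball for a short time, where the projection
    is the identity; there it solves the original equation.\<close>
  have "isCont \<gamma> 0"
    using \<gamma>[of 0] b has_vector_derivative_continuous by auto
  then obtain d where d: "d > 0" "\<And>s. dist s 0 < d \<Longrightarrow> dist (\<gamma> s) (\<gamma> 0) < r"
    using \<open>r > 0\<close> unfolding continuous_at_eps_delta by blast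
  show thesis
  proof (rule that[of "min b d" \<gamma>])
    fix s assume s: "s \<in> {- min b d<..<min b d}"
    then have s': "s \<in> {-b<..<b}" "dist s 0 < d" by (auto simp: abs_less_iff)
    then have "\<gamma> s \<in> cball p r" using d(2)[of s] by (auto simp: \<gamma>0 dist_commute less_imp_le)
    then show "(\<gamma> has_vector_derivative F (\<gamma> s)) (at s)"
      using \<gamma>[OF s'(1)] by (simp add: closest_point_self)
  qed (use b d \<gamma>0 in auto)
qed

lemma integral_curve_exists:
  obtains a \<gamma> where "a > 0" "\<gamma> 0 = p" "integral_curve \<theta> {-a<..<a} \<gamma>"
proof -
  obtain K where K: "K-lipschitz_on (cball p 1) (eval2 (\<theta> var_x))"
    using lipschitz_on_eval2[OF bounded_cball] by blast
  obtain L where L: "L-lipschitz_on (cball p 1) (eval2 (\<theta> var_y))"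
    using lipschitz_on_eval2[OF bounded_cball] by blast
  have "(sqrt (K\<^sup>2 + L\<^sup>2))-lipschitz_on (cball p 1) (vector_field \<theta>)"
    using lipschitz_on_Pair[OF K L] by (simp add: vector_field_def[abs_def])
  then show thesis
    using picard_local[of 1 _ p "vector_field \<theta>"] that
    unfolding integral_curve_def by (metis zero_less_one)
qed

section \<open>Arrangements\<close>

lemma Union_arrangement:
  assumes "line_arrangement \<A>" "defining_polys \<A> \<alpha>"
  shows "\<Union>\<A> = zero_set (arrangement_poly \<A> \<alpha>)"
proof -
  have mem: "p \<in> L \<longleftrightarrow> eval2 (\<alpha> L) p = 0" if "L \<in> \<A>" for L p
    using assms(2) that unfolding defining_polys_def zero_set_def by blast
  have "p \<in> \<Union>\<A> \<longleftrightarrow> eval2 (arrangement_poly \<A> \<alpha>) p = 0" for p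
    using assms(1) mem by (auto simp: arrangement_poly_def eval2_prod line_arrangement_def)
  then show ?thesis by (auto simp: zero_set_def)
qed

text \<open>A finite connected set is empty or a single point, hence not of dimension 1.\<close>

lemma infinite_line:
  fixes L :: "(real \<times> real) set"
  assumes "affine L" "aff_dim L = 1"
  shows "infinite L"
proof
  assume "finite L"
  moreover have "connected L"
    using assms(1) affine_imp_convex convex_connected by blast
  ultimately have "L = {} \<or> (\<exists>a. L = {a})"
    using connected_finite_iff_sing by blast
  with assms(2) show False by auto
qed

text \<open>If the intersection were infinite, the two linear polynomials would divide each other,
  so their zero sets would coincide.\<close>

lemma line_inter_finite:
  assumes "defining_polys \<A> \<alpha>" "L \<in> \<A>" "M \<in> \<A>" "L \<noteq> M"
  shows "finite (L \<inter> M)"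
proof (rule ccontr)
  assume inf: "infinite (L \<inter> M)"
  have *: "total_degree (\<alpha> N) = 1" "zero_set (\<alpha> N) = N" if "N \<in> \<A>" for N
    using assms(1) that unfolding defining_polys_def by blast+
  have "infinite (zero_set (\<alpha> L) \<inter> zero_set (\<alpha> M))"
    using inf *(2)[OF assms(2)] *(2)[OF assms(3)] by simp
  then have "\<alpha> L dvd \<alpha> M" "\<alpha> M dvd \<alpha> L"
    using linear_dvd_if_infinite_zeros *(1) assms by (auto simp: Int_commute)
  moreover have "zero_set g \<subseteq> zero_set h" if "g dvd h" for g h
    using that by (auto simp: zero_set_def elim: dvdE)
  ultimately have "zero_set (\<alpha> L) = zero_set (\<alpha> M)" by blast
  then show False using *(2)[OF assms(2)] *(2)[OF assms(3)] assms(4) by simp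
qed

lemma Der_prod_dvd:
  assumes "\<theta> \<in> Der" "finite A" "\<And>i. i \<in> A \<Longrightarrow> f i dvd \<theta> (f i)"
  shows "prod f A dvd \<theta> (prod f A)"
  using assms(2,3)
proof (induction A rule: finite_induct)
  case empty
  have "\<theta> 1 = 0" using Der_const[OF assms(1), of 1] by (simp add: one_pCons)
  then show ?case by simp
next
  case (insert i A)
  have "\<theta> (f i * prod f A) = f i * \<theta> (prod f A) + prod f A * \<theta> (f i)"
    using assms(1) unfolding Der_def by blast
  moreover have "f i * prod f A dvd f i * \<theta> (prod f A)"
    using insert by (intro mult_dvd_mono) auto
  moreover have "f i * prod f A dvd prod f A * \<theta> (f i)"
    using insert by (subst mult.commute) (intro mult_dvd_mono, auto)
  ultimately show ?case using insert by simp
qed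

text \<open>In the application \<open>l\<close> defines one line and \<open>U\<close> is the union
  of the others. As \<open>U\<close> is closed and misses \<open>p\<close>, the integral curve
  through \<open>p\<close> avoids \<open>U\<close> for a short time; invariance then keeps it in the
  zero set of \<open>l\<close>.\<close>

lemma Der_vanishes_if_locally_invariant:
  assumes "\<theta> \<in> Der" and inv: "invariant_set \<theta> (zero_set l \<union> U)"
    and "closed U" "p \<in> zero_set l" "p \<notin> U"
  shows "eval2 (\<theta> l) p = 0"
proof -
  obtain a \<gamma> where a: "a > 0" and \<gamma>0: "\<gamma> 0 = p" and \<gamma>: "integral_curve \<theta> {-a<..<a} \<gamma>"
    using integral_curve_exists .
  have \<gamma>': "(\<gamma> has_vector_derivative vector_field \<theta> (\<gamma> 0)) (at 0)"
    using \<gamma> a by (auto simp: integral_curve_def)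
  have in_X: "\<gamma> s \<in> zero_set l \<union> U" if "s \<in> {-a<..<a}" for s
  proof -
    have "flow_rel \<theta> s p (\<gamma> s)"
      unfolding flow_rel_def
      by (rule exI[of _ "{-a<..<a}"], rule exI[of _ \<gamma>])
        (use a that \<gamma> \<gamma>0 in \<open>auto simp: is_interval_1\<close>)
    then show ?thesis using inv \<open>p \<in> zero_set l\<close> unfolding invariant_set_def by blast
  qed
  have "isCont \<gamma> 0" using \<gamma>' has_vector_derivative_continuous by blast
  then have "\<gamma> \<midarrow>0\<rightarrow> p" by (simp add: isCont_def \<gamma>0)
  then have "\<forall>\<^sub>F s in at 0. \<gamma> s \<in> - U"
    using \<open>closed U\<close> \<open>p \<notin> U\<close> by (intro topological_tendstoD) auto
  \<comment> \<open>The limit controls only nonzero times; time 0 is added because comparing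
    derivatives at 0 requires equality on a full neighbourhood.\<close>
  then have "\<forall>\<^sub>F s in nhds 0. \<gamma> s \<in> - U"
    using \<open>p \<notin> U\<close> \<gamma>0 by (simp add: eventually_nhds_conv_at)
  moreover have "\<forall>\<^sub>F s in nhds 0. s \<in> {-a<..<a}"
    using a by (intro eventually_nhds_in_open) auto
  ultimately have "\<forall>\<^sub>F s in nhds 0. eval2 l (\<gamma> s) = 0"
    by eventually_elim (use in_X in \<open>auto simp: zero_set_def\<close>)
  moreover have "((\<lambda>s. eval2 l (\<gamma> s)) has_real_derivative eval2 (\<theta> l) (\<gamma> 0)) (at 0)"
    by (rule has_real_derivative_eval2[OF assms(1) \<gamma>'])
  \<comment> \<open>Along the curve \<open>l\<close> agrees near time 0 with the zero function,
    whose derivative is 0.\<close>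
  ultimately have "((\<lambda>s. 0) has_real_derivative eval2 (\<theta> l) p) (at 0)"
    using DERIV_cong_ev[of 0 0 "\<lambda>s. eval2 l (\<gamma> s)" "\<lambda>s. 0"] \<gamma>0 by simp
  then show ?thesis using DERIV_unique DERIV_const by blast
qed

theorem lemma2p1:
  fixes \<A> :: "(real \<times> real) set set"
    and \<alpha> :: "(real \<times> real) set \<Rightarrow> bipoly"
    and \<theta> :: "bipoly \<Rightarrow> bipoly"
  assumes "line_arrangement \<A>"
    and "defining_polys \<A> \<alpha>"
    and "\<theta> \<in> Der"
  shows "\<theta> \<in> arrangement_derivations \<A> \<alpha> \<longleftrightarrow> invariant_arrangement \<theta> \<A>"
proof
  assume "\<theta> \<in> arrangement_derivations \<A> \<alpha>"
  then obtain k where k: "\<theta> (arrangement_poly \<A> \<alpha>) = k * arrangement_poly \<A> \<alpha>"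
    by (auto simp: arrangement_derivations_def principal_ideal_def)
  define Q where "Q = arrangement_poly \<A> \<alpha>"
  have "eval2 Q q = 0" if p: "eval2 Q p = 0" and "flow_rel \<theta> t p q" for t p q
  proof -
    obtain J \<gamma> where J: "is_interval J" "0 \<in> J" "t \<in> J"
      and \<gamma>: "integral_curve \<theta> J \<gamma>" "\<gamma> 0 = p" "\<gamma> t = q"
      using \<open>flow_rel \<theta> t p q\<close> by (auto simp: flow_rel_def)
    have \<gamma>': "(\<gamma> has_vector_derivative vector_field \<theta> (\<gamma> s)) (at s)" if "s \<in> J" for s
      using \<gamma>(1) that by (simp add: integral_curve_def)
    have "continuous_on J \<gamma>"
      using \<gamma>' by (meson has_vector_derivative_at_within continuous_on_vector_derivative)
    moreover have "((\<lambda>s. eval2 Q (\<gamma> s)) has_real_derivative eval2 k (\<gamma> s) * eval2 Q (\<gamma> s)) (at s)"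
      if "s \<in> J" for s
      using has_real_derivative_eval2[OF assms(3) \<gamma>'[OF that], of Q] k by (simp add: Q_def)
    ultimately have "eval2 Q (\<gamma> t) = 0"
      using J p \<gamma>
      by (intro linear_ode_zero[of J 0 t "\<lambda>s. eval2 Q (\<gamma> s)" "\<lambda>s. eval2 k (\<gamma> s)"])
        (auto intro: continuous_intros)
    then show ?thesis by (simp add: \<gamma>)
  qed
  then show "invariant_arrangement \<theta> \<A>"
    using Union_arrangement[OF assms(1,2)]
    by (auto simp: invariant_arrangement_def invariant_set_def zero_set_def Q_def)
next
  assume inv: "invariant_arrangement \<theta> \<A>"
  have fin: "finite \<A>" and line: "\<And>L. L \<in> \<A> \<Longrightarrow> affine L \<and> aff_dim L = 1"
    using assms(1) by (auto simp: line_arrangement_def)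
  have "\<alpha> L dvd \<theta> (\<alpha> L)" if L: "L \<in> \<A>" for L
  proof -
    have deg: "total_degree (\<alpha> L) = 1" and zL: "zero_set (\<alpha> L) = L"
      using assms(2) L unfolding defining_polys_def by blast+
    define U where "U = \<Union>(\<A> - {L})"
    have "closed U"
      unfolding U_def using fin line by (intro closed_Union ballI) (auto intro: affine_closed)
    \<comment> \<open>Each of the finitely many other lines removes only finitely many points from
      the infinite set \<open>L\<close>, so infinitely many points of \<open>L\<close> lie on no
      other line.\<close>
    have "finite (\<Union>M\<in>\<A> - {L}. L \<inter> M)"
      using fin line_inter_finite[OF assms(2) L] by blast
    moreover have "L \<inter> U = (\<Union>M\<in>\<A> - {L}. L \<inter> M)" by (auto simp: U_def)
    ultimately have "finite (L \<inter> U)" by simp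
    then have inf: "infinite (L - U)"
      using infinite_line[of L] line[OF L] Diff_infinite_finite[of "L \<inter> U" L]
      by (simp add: Diff_Int)
    have "zero_set (\<alpha> L) \<union> U = \<Union>\<A>" using L zL by (auto simp: U_def)
    then have inv': "invariant_set \<theta> (zero_set (\<alpha> L) \<union> U)"
      using inv by (simp add: invariant_arrangement_def)
    have "L - U \<subseteq> zero_set (\<alpha> L) \<inter> zero_set (\<theta> (\<alpha> L))"
      using Der_vanishes_if_locally_invariant[OF assms(3) inv' \<open>closed U\<close>] zL
      by (auto simp: zero_set_def)
    then show ?thesis
      using linear_dvd_if_infinite_zeros[OF deg] inf finite_subset by blast
  qed
  then have "arrangement_poly \<A> \<alpha> dvd \<theta> (arrangement_poly \<A> \<alpha>)"
    unfolding arrangement_poly_def using Der_prod_dvd[OF assms(3) fin] by blast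
  then show "\<theta> \<in> arrangement_derivations \<A> \<alpha>"
    using assms(3)
    by (auto simp: arrangement_derivations_def principal_ideal_def dvd_def mult.commute)
qed

end
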